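(* Let $d \ge 0$, $p \ge 1$ and $N \ge 0$ be integers. The cone $$C_N = \{h \in \mathbb{R}^{p(d+1)} : L_h(n+1) \ge L_h(n) \text{ for all integers } n \ge N\}$$ is polyhedral (i.e. the solution set of finitely many linear inequalities) if and only if $d = 1$ or $d = 2$.
   Context: A vector $h \in \mathbb{R}^{p(d+1)}$ is indexed as $h = (h_0, h_1, \dots, h_{p(d+1)-1})$, and we write $h_{r,j} := h_{jp+r}$ for $0 \le r \le p-1$ and $0 \le j \le d$. Put $h(z) := \sum_i h_i z^i$ and define $L_h : \mathbb{Z}_{\ge 0} \to \mathbb{R}$ by $\sum_{n \ge 0} L_h(n) z^n := h(z)/(1-z^p)^{d+1}$; equivalently, $L_h(tp+r) = \sum_{j=0}^d h_{r,j}\binom{t+d-j}{d}$ for $t \ge 0$, $0 \le r \le p-1$.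
   Formalization: The formal theorem assumes d ≥ 1 instead of d ≥ 0: for d = 0 the function L_h is p-periodic, so C_N is the line of vectors with all coordinates equal, which is polyhedral, and the stated equivalence fails. *)

theory Defs
  imports "HOL-Analysis.Analysis" "HOL-Computational_Algebra.Formal_Power_Series"
begin

(* Coordinate vectors live in real ^ 'n, where 'n is a finite type with p * (d + 1) elements.
   The map e enumerates 'n, so that h $ e i is the coordinate h_i for 0 <= i < p * (d + 1). *)

definition h_series :: "(nat \<Rightarrow> 'n::finite) \<Rightarrow> nat \<Rightarrow> nat \<Rightarrow> real ^ 'n \<Rightarrow> real fps" where
  "h_series e p d h = (\<Sum>i<p * (d + 1). fps_const (h $ e i) * fps_X ^ i)"

(* For p >= 1 the denominator has constant term 1, so the quotient is the usual one of formal
   power series. *)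
definition L :: "(nat \<Rightarrow> 'n::finite) \<Rightarrow> nat \<Rightarrow> nat \<Rightarrow> real ^ 'n \<Rightarrow> nat \<Rightarrow> real" where
  "L e p d h n = fps_nth (h_series e p d h / (1 - fps_X ^ p) ^ (d + 1)) n"

definition C :: "(nat \<Rightarrow> 'n::finite) \<Rightarrow> nat \<Rightarrow> nat \<Rightarrow> nat \<Rightarrow> (real ^ 'n) set" where
  "C e p d N = {h. \<forall>n\<ge>N. L e p d h (n + 1) \<ge> L e p d h n}"

lemma L_0_rec:
  assumes "p \<ge> 1"
  shows "L e p 0 h n = (if n < p then h $ e n else L e p 0 h (n - p))"
proof -
  define H where "H = h_series e p 0 h"
  define F where "F = H / (1 - fps_X ^ p)"
  have u: "fps_nth (1 - fps_X ^ p :: real fps) 0 \<noteq> 0"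
    using assms by simp
  have "F * (1 - fps_X ^ p) = H"
    using inverse_mult_eq_1[OF u] by (simp add: F_def fps_divide_unit[OF u] mult.assoc)
  then have "fps_nth H n = fps_nth F n - fps_nth (fps_X ^ p * F) n"
    by (metis fps_sub_nth mult.commute mult.right_neutral right_diff_distrib)
  moreover have "fps_nth H n = (if n < p then h $ e n else 0)"
    by (auto simp: H_def h_series_def fps_sum_nth if_distrib [of "\<lambda>x. _ * x"] cong: if_cong)
  ultimately show ?thesis
    by (auto simp: L_def F_def H_def fps_X_power_mult_nth)
qed

(* If d = 0, then L_h is p-periodic, so C_N is the line of vectors with all coordinates equal,
   which is a polyhedron. This degenerate case has to be excluded from the claim that C_N is
   polyhedral if and only if d = 1 or d = 2. *)
lemma polyhedron_C_0:
  fixes e :: "nat \<Rightarrow> 'n::finite"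
  assumes p: "p \<ge> 1" and e: "bij_betw e {..<p} (UNIV :: 'n set)"
  shows "polyhedron (C e p 0 N)"
proof -
  have lt: "L e p 0 h n = h $ e n" if "n < p" for h n
    using L_0_rec[OF p, of e h n] that by simp
  have per: "L e p 0 h (k * p + n) = L e p 0 h n" for h k n
  proof (induction k)
    case (Suc k)
    then show ?case using L_0_rec[OF p, of e h "Suc k * p + n"] by (simp add: add.assoc)
  qed simp
  have C_eq: "C e p 0 N = {h. \<forall>j. h $ j = h $ e 0}"
  proof (intro set_eqI iffI)
    fix h assume "h \<in> C e p 0 N"
    then have step_le: "L e p 0 h n \<le> L e p 0 h (Suc n)" if "n \<ge> N" for n
      using that by (auto simp: C_def)
    have mono: "L e p 0 h m \<le> L e p 0 h n" if "N \<le> m" "m \<le> n" for m n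
      using that(2)
    proof (induction rule: dec_induct)
      case (step k)
      then show ?case using step_le[of k] that(1) by simp
    qed simp
    have all: "h $ e i = h $ e 0" if "i < p" for i
    proof (rule antisym)
      have N: "N \<le> N * p" using p by simp
      have "L e p 0 h (N * p + 0) \<le> L e p 0 h (N * p + i)"
        by (rule mono) (use N in linarith)+
      then show "h $ e 0 \<le> h $ e i"
        unfolding per using lt[of i] lt[of 0] that p by simp
      have "L e p 0 h (N * p + i) \<le> L e p 0 h (Suc N * p + 0)"
        using N that by (intro mono) (simp_all add: trans_le_add1)
      then show "h $ e i \<le> h $ e 0"
        unfolding per using lt[of i] lt[of 0] that p by simp
    qed
    have "h $ j = h $ e 0" for j
    proof -
      obtain i where i: "i < p" "j = e i"
        using bij_betw_imp_surj_on[OF e] by blast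
      show ?thesis unfolding i(2) by (rule all[OF i(1)])
    qed
    then show "h \<in> {h. \<forall>j. h $ j = h $ e 0}" by blast
  next
    fix h :: "real ^ 'n" assume "h \<in> {h. \<forall>j. h $ j = h $ e 0}"
    then have h: "h $ j = h $ e 0" for j by blast
    have "L e p 0 h n = h $ e 0" for n
    proof -
      have "L e p 0 h n = L e p 0 h (n mod p)"
        using per[of h "n div p" "n mod p"] by simp
      also have "\<dots> = h $ e (n mod p)"
        using p by (intro lt) simp
      also have "\<dots> = h $ e 0" by (rule h)
      finally show ?thesis .
    qed
    then show "h \<in> C e p 0 N" by (simp add: C_def)
  qed
  have "{h. \<forall>j. h $ j = h $ e 0}
      = (\<Inter>j. {h::real^'n. (axis j 1 - axis (e 0) 1) \<bullet> h \<le> 0} \<inter> {h. (axis (e 0) 1 - axis j 1) \<bullet> h \<le> 0})"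
    by (auto simp: inner_diff_left inner_axis' intro: antisym eq_refl eq_refl[OF sym])
  also have "polyhedron \<dots>"
    by (rule polyhedron_Inter) (auto intro!: polyhedron_Int polyhedron_halfspace_le)
  finally show ?thesis unfolding C_eq .
qed

end

theory Submission
  imports Defs
begin

text \<open>
  Let \<open>\<Delta>\<close> be the difference operator with step \<open>p\<close>. The functions \<open>L h\<close> are exactly the sequences
  annihilated by \<open>\<Delta>^(d+1)\<close>. Put \<open>f n = L h (n + 1) - L h n\<close>.

  If \<open>h\<close> lies in the cone, then \<open>f\<close> is eventually nonnegative, so \<open>\<Delta>^d f \<ge> 0\<close> (this is a leading
  coefficient). Moreover, \<open>\<Delta>^d f\<close> sums up to \<open>\<Delta>^(d+1) (L h) = 0\<close> over \<open>p\<close> consecutive arguments, hence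
  it vanishes and \<open>\<Delta>^(d-1) f \<ge> 0\<close> is a leading coefficient, too. For \<open>d \<le> 2\<close>, the cone
  is therefore cut out by the inequalities \<open>\<Delta>^k f n \<ge> 0\<close> for \<open>k \<le> d\<close> and \<open>N \<le> n < N + p\<close>.

  If \<open>d \<ge> 3\<close>, then every polynomial of degree 3 occurs among the functions \<open>L h\<close>, in particular one with
  \<open>f n = (n - m)^2\<close>. It shows that the faces of the cone given by \<open>f m = 0\<close> for \<open>m \<ge> N\<close> are pairwise
  distinct, but a polyhedron has only finitely many faces.
\<close>

section \<open>Differences with step \<open>p\<close> and their signs\<close>

definition step_diff :: "nat \<Rightarrow> (nat \<Rightarrow> real) \<Rightarrow> nat \<Rightarrow> real" where
  "step_diff p u n = u (n + p) - u n"

lemma step_diff_zero [simp]: "step_diff p (\<lambda>n. 0) = (\<lambda>n. 0)"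
  by (simp add: step_diff_def fun_eq_iff)

lemma funpow_step_diff_zero [simp]: "(step_diff p ^^ k) (\<lambda>n. 0) = (\<lambda>n. 0)"
  by (induction k) simp_all

lemma funpow_step_diff_eq_0_mono:
  assumes "(step_diff p ^^ k) u = (\<lambda>n. 0)" and "k \<le> l"
  shows "(step_diff p ^^ l) u = (\<lambda>n. 0)"
proof -
  have "(step_diff p ^^ l) u = (step_diff p ^^ (l - k)) ((step_diff p ^^ k) u)"
    using assms(2) by (simp flip: comp_apply[of "step_diff p ^^ (l - k)"] funpow_add)
  then show ?thesis
    using assms(1) by simp
qed

lemma step_diff_commute: "step_diff p (step_diff q u) = step_diff q (step_diff p u)"
  by (simp add: step_diff_def fun_eq_iff algebra_simps)

lemma funpow_step_diff_commute:
  "(step_diff p ^^ k) (step_diff q u) = step_diff q ((step_diff p ^^ k) u)"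
  by (induction k) (simp_all add: step_diff_commute)

lemma sum_step_diff_1: "(\<Sum>i<p. step_diff 1 u (n + i)) = step_diff p u n"
  using sum_lessThan_telescope[of "\<lambda>i. u (n + i)" p] by (simp add: step_diff_def)

text \<open>Increments of at most \<open>- c\<close> along the progression \<open>n + t * p\<close>
  make \<open>u\<close> decrease there at least linearly, so it ends up below
  \<open>- 1\<close>.\<close>

lemma step_diff_negative_imp_negative:
  assumes "c > 0" and "\<And>t. t \<ge> T \<Longrightarrow> step_diff p u (n + t * p) \<le> - c"
  shows "\<exists>c>0. \<exists>T. \<forall>t\<ge>T. u (n + t * p) \<le> - c"
proof -
  have le: "u (n + (T + s) * p) \<le> u (n + T * p) - c * s" for s :: nat
  proof (induction s)
    case (Suc s)
    then show ?case
      using assms(2)[of "T + s"] by (simp add: step_diff_def algebra_simps)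
  qed simp
  \<comment> \<open>After \<open>M\<close> steps the total decrease \<open>c * M\<close> exceeds the
    starting value by more than 1.\<close>
  obtain M :: nat where M: "(u (n + T * p) + 1) / c < M"
    using reals_Archimedean2 by blast
  have "u (n + t * p) \<le> - 1" if "t \<ge> T + M" for t
  proof -
    define s where "s = t - T"
    then have s: "t = T + s" "s \<ge> M"
      using that by auto
    have "u (n + T * p) + 1 \<le> c * M"
      using M assms(1) by (simp add: field_simps)
    also have "\<dots> \<le> c * s"
      using s(2) assms(1) by simp
    finally show ?thesis
      using le[of s] by (simp add: s(1))
  qed
  then show ?thesis
    by (intro exI[of _ 1]) auto
qed

lemma funpow_step_diff_negative_imp_negative:
  assumes "\<exists>c>0. \<exists>T. \<forall>t\<ge>T. (step_diff p ^^ k) u (n + t * p) \<le> - c"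
  shows "\<exists>c>0. \<exists>T. \<forall>t\<ge>T. u (n + t * p) \<le> - c"
  using assms
proof (induction k arbitrary: u)
  case (Suc k)
  have "\<exists>c>0. \<exists>T. \<forall>t\<ge>T. step_diff p u (n + t * p) \<le> - c"
    by (rule Suc.IH) (use Suc.prems in \<open>simp add: funpow_Suc_right del: funpow.simps\<close>)
  then show ?case
    using step_diff_negative_imp_negative by blast
qed simp

text \<open>As the next difference vanishes, the \<open>k\<close>-th one is constant along
  \<open>n + t * p\<close>. A negative constant would, after \<open>k\<close> summations, drag
  \<open>u\<close> itself below zero far out on this progression.\<close>

lemma leading_step_diff_nonneg:
  assumes "p \<ge> 1" and zero: "(step_diff p ^^ Suc k) u = (\<lambda>n. 0)"
    and nonneg: "\<And>n. n \<ge> N \<Longrightarrow> u n \<ge> 0"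
  shows "(step_diff p ^^ k) u n \<ge> 0"
proof (rule ccontr)
  assume neg: "\<not> (step_diff p ^^ k) u n \<ge> 0"
  have "(step_diff p ^^ k) u (n + t * p) = (step_diff p ^^ k) u n" for t
  proof (induction t)
    case (Suc t)
    have "step_diff p ((step_diff p ^^ k) u) (n + t * p) = 0"
      using zero by simp
    then show ?case
      using Suc by (simp add: step_diff_def[of p "(step_diff p ^^ k) u"] ac_simps)
  qed simp
  then have "\<exists>c>0. \<exists>T. \<forall>t\<ge>T. (step_diff p ^^ k) u (n + t * p) \<le> - c"
    using neg by (intro exI[of _ "- (step_diff p ^^ k) u n"]) simp
  then obtain c T where c: "c > 0" "\<And>t. t \<ge> T \<Longrightarrow> u (n + t * p) \<le> - c"
    using funpow_step_diff_negative_imp_negative by blast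
  \<comment> \<open>The index \<open>n + max T N * p\<close> lies in the range of both sign
    conditions on \<open>u\<close>.\<close>
  have "N \<le> max T N * p"
    using assms(1) mult_le_mono[of N "max T N" 1 p] by simp
  then show False
    using c(2)[of "max T N"] c(1) nonneg[of "n + max T N * p"] by simp
qed

text \<open>Induction on \<open>k\<close>, applied to \<open>step_diff p u\<close>: once this is
  nonnegative from \<open>N\<close> on, steps of length \<open>p\<close> do not decrease
  \<open>u\<close>, and nonnegativity spreads from the window of length \<open>p\<close>.\<close>

lemma nonneg_from_initial_step_diffs:
  assumes "p \<ge> 1" and "(step_diff p ^^ Suc k) u = (\<lambda>n. 0)"
    and "\<And>i n. i \<le> k \<Longrightarrow> n \<in> {N..<N + p} \<Longrightarrow> (step_diff p ^^ i) u n \<ge> 0"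
    and "n \<ge> N"
  shows "u n \<ge> 0"
  using assms(2-)
proof (induction k arbitrary: u n)
  case 0
  from \<open>n \<ge> N\<close> show ?case
  proof (induction n rule: less_induct)
    case (less n)
    show ?case
    proof (cases "n < N + p")
      case False
      moreover have "step_diff p u (n - p) = 0"
        using 0 by simp
      ultimately show ?thesis
        using less.IH[of "n - p"] assms(1) by (simp add: step_diff_def)
    qed (use "0.prems"(2)[of 0 n] less.prems in simp)
  qed
next
  case (Suc k)
  have nonneg: "step_diff p u m \<ge> 0" if "m \<ge> N" for m
  proof (rule Suc.IH)
    show "(step_diff p ^^ Suc k) (step_diff p u) = (\<lambda>n. 0)"
      using Suc.prems(1) by (simp add: funpow_step_diff_commute)
    show "(step_diff p ^^ i) (step_diff p u) j \<ge> 0" if "i \<le> k" "j \<in> {N..<N + p}" for i j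
      using Suc.prems(2)[of "Suc i" j] that by (simp add: funpow_step_diff_commute)
  qed fact
  from \<open>n \<ge> N\<close> show ?case
  proof (induction n rule: less_induct)
    case (less n)
    show ?case
    proof (cases "n < N + p")
      case False
      then have "N \<le> n - p"
        by simp
      then show ?thesis
        using False less.IH[of "n - p"] nonneg[of "n - p"] assms(1) by (simp add: step_diff_def)
    qed (use Suc.prems(2)[of 0 n] less.prems in simp)
  qed
qed

section \<open>The functions \<open>L h\<close> as the kernel of a power of
  \<open>step_diff p\<close>\<close>

text \<open>Multiplication by \<open>1 - fps_X ^ p\<close> subtracts from each coefficient the one
  \<open>p\<close> places earlier. The offset \<open>k * p\<close> skips the initial coefficients,
  where such predecessors are missing.\<close>

lemma fps_nth_one_minus_X_power_mult:
  "fps_nth ((1 - fps_X ^ p) ^ k * U) (n + k * p) = (step_diff p ^^ k) (fps_nth U) n"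
proof (induction k arbitrary: n)
  case (Suc k)
  define V where "V = (1 - fps_X ^ p) ^ k * U"
  have "(1 - fps_X ^ p) ^ Suc k * U = V - fps_X ^ p * V"
    by (simp add: V_def algebra_simps)
  then have "fps_nth ((1 - fps_X ^ p) ^ Suc k * U) (n + Suc k * p)
      = fps_nth V ((n + p) + k * p) - fps_nth V (n + k * p)"
    by (simp add: fps_X_power_mult_nth add.assoc add.left_commute del: power_Suc)
  also have "\<dots> = (step_diff p ^^ Suc k) (fps_nth U) n"
    unfolding V_def Suc.IH by (simp add: step_diff_def)
  finally show ?case .
qed simp

lemma one_minus_X_power_nth_0:
  assumes "p \<ge> 1"
  shows "fps_nth ((1 - fps_X ^ p) ^ k :: real fps) 0 \<noteq> 0"
  using assms by (simp add: fps_power_zeroth power_0_left)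

lemma fps_nth_Abs_fps: "fps_nth (Abs_fps u) = u"
  by (simp add: fun_eq_iff)

lemma fps_nth_h_series:
  "fps_nth (h_series e p d h) n = (if n < p * (d + 1) then h $ e n else 0)"
  by (auto simp: h_series_def fps_sum_nth if_distrib [of "\<lambda>x. _ * x"] cong: if_cong)

lemma h_series_eq_mult_L:
  assumes "p \<ge> 1"
  shows "(1 - fps_X ^ p) ^ (d + 1) * Abs_fps (L e p d h) = h_series e p d h"
proof -
  note u = one_minus_X_power_nth_0[OF assms, of "d + 1"]
  have "Abs_fps (L e p d h) = h_series e p d h * inverse ((1 - fps_X ^ p) ^ (d + 1))"
    unfolding fps_divide_unit[OF u, symmetric] by (simp add: fps_eq_iff L_def)
  then show ?thesis
    using inverse_mult_eq_1[OF u] by (simp add: ac_simps)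
qed

text \<open>These differences are coefficients of \<open>h_series\<close> at indices from
  \<open>p * (d + 1)\<close> on, beyond its degree.\<close>

lemma funpow_step_diff_L:
  assumes "p \<ge> 1"
  shows "(step_diff p ^^ Suc d) (L e p d h) = (\<lambda>n. 0)"
proof
  fix n
  show "(step_diff p ^^ Suc d) (L e p d h) n = 0"
    using fps_nth_one_minus_X_power_mult[of p "Suc d" "Abs_fps (L e p d h)" n]
      h_series_eq_mult_L[OF assms, of d e h]
    by (simp add: fps_nth_h_series fps_nth_Abs_fps algebra_simps del: power_Suc funpow.simps)
qed

text \<open>Converse: multiplying the generating function of \<open>u\<close> by the denominator
  leaves a polynomial of degree below \<open>p * (d + 1)\<close>, whose coefficients serve as
  \<open>h\<close>. Injectivity of \<open>e\<close> allows them to be prescribed freely.\<close>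

lemma ex_L_eq:
  fixes e :: "nat \<Rightarrow> 'n::finite"
  assumes p: "p \<ge> 1" and e: "inj_on e {..<p * (d + 1)}"
    and u: "(step_diff p ^^ Suc d) u = (\<lambda>n. 0)"
  obtains h :: "real ^ 'n" where "L e p d h = u"
proof -
  define D :: "real fps" where "D = (1 - fps_X ^ p) ^ (d + 1)"
  define h :: "real ^ 'n" where
    "h = (\<chi> j. fps_nth (D * Abs_fps u) (the_inv_into {..<p * (d + 1)} e j))"
  have D: "fps_nth D 0 \<noteq> 0"
    unfolding D_def by (rule one_minus_X_power_nth_0[OF p])
  have "h_series e p d h = D * Abs_fps u"
  proof (rule fps_ext)
    fix n
    show "fps_nth (h_series e p d h) n = fps_nth (D * Abs_fps u) n"
    proof (cases "n < p * (d + 1)")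
      case True
      then show ?thesis
        using e by (simp add: fps_nth_h_series h_def the_inv_into_f_f)
    next
      case False
      define m where "m = n - Suc d * p"
      then have m: "n = m + Suc d * p"
        using False by (simp add: algebra_simps)
      show ?thesis
        using False fps_nth_one_minus_X_power_mult[of p "Suc d" "Abs_fps u" m] u
        by (simp add: fps_nth_h_series D_def m fps_nth_Abs_fps del: power_Suc funpow.simps)
    qed
  qed
  then have "h_series e p d h / D = Abs_fps u"
    using inverse_mult_eq_1[OF D] by (simp add: fps_divide_unit[OF D] ac_simps)
  then have "L e p d h = u"
    by (simp add: L_def D_def fun_eq_iff)
  then show ?thesis
    by (rule that)
qed

section \<open>Linearity in \<open>h\<close> and half-spaces\<close>

lemma linear_L:
  assumes "p \<ge> 1"
  shows "linear (\<lambda>h. L e p d h n)"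
proof -
  note u = one_minus_X_power_nth_0[OF assms, of "d + 1"]
  have "h_series e p d (x + y) = h_series e p d x + h_series e p d y" for x y
    by (simp add: fps_eq_iff fps_nth_h_series)
  moreover have "h_series e p d (c *\<^sub>R x) = fps_const c * h_series e p d x" for c x
    by (simp add: fps_eq_iff fps_nth_h_series)
  ultimately show ?thesis
    by (intro linearI)
      (simp_all only: L_def fps_divide_unit[OF u] distrib_right mult.assoc fps_add_nth
        fps_mult_left_const_nth real_scaleR_def)
qed

lemma linear_funpow_step_diff:
  assumes "\<And>n. linear (\<lambda>h. g h n)"
  shows "linear (\<lambda>h. (step_diff p ^^ k) (g h) n)"
  by (induction k arbitrary: n) (simp_all add: assms step_diff_def linear_compose_sub)

lemma linear_step_diff_L:
  assumes "p \<ge> 1"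
  shows "linear (\<lambda>h. step_diff q (L e p d h) n)"
  using linear_funpow_step_diff[where k = 1 and g = "L e p d", OF linear_L[OF assms]] by simp

lemma linear_functional_eq_inner:
  fixes f :: "'a::euclidean_space \<Rightarrow> real"
  assumes "linear f"
  obtains a where "\<And>x. f x = a \<bullet> x"
  by (rule that[of "adjoint f 1"]) (use adjoint_works[OF assms, of _ 1] in \<open>simp add: inner_commute\<close>)

lemma polyhedron_linear_ge_0:
  fixes f :: "'a::euclidean_space \<Rightarrow> real"
  assumes "linear f"
  shows "polyhedron {x. f x \<ge> 0}"
proof -
  obtain a where "\<And>x. f x = a \<bullet> x"
    using linear_functional_eq_inner[OF assms] by blast
  then show ?thesis
    by (simp add: polyhedron_halfspace_ge)
qed

section \<open>The cone is polyhedral for \<open>d = 1\<close> and \<open>d = 2\<close>\<close>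

lemma C_eq_step_diff: "C e p d N = {h. \<forall>n\<ge>N. step_diff 1 (L e p d h) n \<ge> 0}"
  by (simp add: C_def step_diff_def)

lemma funpow_step_diff_C:
  assumes p: "p \<ge> 1" and h: "h \<in> C e p d N"
  shows "(step_diff p ^^ d) (step_diff 1 (L e p d h)) = (\<lambda>n. 0)"
proof
  fix n
  let ?g = "(step_diff p ^^ d) (step_diff 1 (L e p d h))"
  have zero: "(step_diff p ^^ Suc d) (step_diff 1 (L e p d h)) = (\<lambda>n. 0)"
    unfolding funpow_step_diff_commute funpow_step_diff_L[OF p] by simp
  have "?g m \<ge> 0" for m
    by (rule leading_step_diff_nonneg[OF p zero, of N]) (use h in \<open>simp add: C_eq_step_diff\<close>)
  \<comment> \<open>With \<open>step_diff 1\<close> moved outermost, the sum telescopes to the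
    \<open>(d + 1)\<close>-st difference of \<open>L h\<close>.\<close>
  moreover have "(\<Sum>i<p. ?g (n + i)) = 0"
    unfolding funpow_step_diff_commute sum_step_diff_1
    using fun_cong[OF funpow_step_diff_L[OF p, of d e h], of n] by simp
  ultimately have "?g (n + i) = 0" if "i < p" for i
    using that by (subst (asm) sum_nonneg_eq_0_iff) auto
  from this[of 0] show "?g n = 0"
    using p by simp
qed

lemma polyhedron_C:
  assumes p: "p \<ge> 1" and "d = 1 \<or> d = 2"
  shows "polyhedron (C e p d N)"
proof -
  let ?f = "\<lambda>h. step_diff 1 (L e p d h)"
  have "C e p d N = (\<Inter>(k, n) \<in> {..d} \<times> {N..<N + p}. {h. (step_diff p ^^ k) (?f h) n \<ge> 0})"
    (is "_ = ?S")
  proof (intro equalityI subsetI)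
    fix h assume h: "h \<in> C e p d N"
    then have nonneg: "?f h n \<ge> 0" if "n \<ge> N" for n
      using that by (simp add: C_eq_step_diff)
    have "(step_diff p ^^ k) (?f h) n \<ge> 0" if kn: "k \<le> d" "n \<ge> N" for k n
    proof -
      \<comment> \<open>Only here does \<open>d \<le> 2\<close> enter: every order is the vanishing
        \<open>d\<close>-th one, the function itself, or the leading one
        \<open>d - 1\<close>.\<close>
      consider "k = d" | "k = 0" | "Suc k = d"
        using assms(2) kn(1) by linarith
      then show ?thesis
      proof cases
        case 3
        then have "(step_diff p ^^ Suc k) (?f h) = (\<lambda>n. 0)"
          using funpow_step_diff_C[OF p h] by simp
        then show ?thesis
          using nonneg by (rule leading_step_diff_nonneg[OF p])
      qed (use funpow_step_diff_C[OF p h] nonneg kn in simp_all)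
    qed
    then show "h \<in> ?S"
      by auto
  next
    fix h assume "h \<in> ?S"
    then have h: "(step_diff p ^^ k) (?f h) n \<ge> 0" if "k \<le> d" "n \<in> {N..<N + p}" for k n
      using that by blast
    have "(step_diff p ^^ Suc d) (?f h) = (\<lambda>n. 0)"
      unfolding funpow_step_diff_commute funpow_step_diff_L[OF p] by simp
    then have "?f h n \<ge> 0" if "n \<ge> N" for n
      using nonneg_from_initial_step_diffs[OF p _ h] that by blast
    then show "h \<in> C e p d N"
      by (simp add: C_eq_step_diff)
  qed
  moreover have "polyhedron ?S"
    by (intro polyhedron_Inter)
      (auto intro!: polyhedron_linear_ge_0 linear_funpow_step_diff linear_step_diff_L p)
  ultimately show ?thesis
    by simp
qed

section \<open>Infinitely many faces for \<open>d \<ge> 3\<close>\<close>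

lemma not_polyhedron_C:
  fixes e :: "nat \<Rightarrow> 'n::finite"
  assumes p: "p \<ge> 1" and e: "inj_on e {..<p * (d + 1)}" and d: "d \<ge> 3"
  shows "\<not> polyhedron (C e p d N)"
proof
  let ?f = "\<lambda>h. step_diff 1 (L e p d h)"
  define G where "G m = C e p d N \<inter> {h. ?f h m = 0}" for m
  assume poly: "polyhedron (C e p d N)"
  have face: "G m face_of C e p d N" if "m \<ge> N" for m
  proof -
    obtain a where a: "\<And>h. ?f h m = a \<bullet> h"
      using linear_functional_eq_inner[OF linear_step_diff_L[OF p]] by blast
    have "a \<bullet> h \<ge> 0" if "h \<in> C e p d N" for h
      using that \<open>m \<ge> N\<close> unfolding a[symmetric] by (simp add: C_eq_step_diff)
    then show ?thesis
      unfolding G_def a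
      using face_of_Int_supporting_hyperplane_ge[OF polyhedron_imp_convex[OF poly]] by blast
  qed
  have neq: "G m \<noteq> G k" if "m \<noteq> k" for m k
  proof -
    \<comment> \<open>With \<open>x = n - m\<close> this is
      \<open>x * (x - 1) * (2 * x - 1) / 6\<close>, the polynomial for the sum of the squares below
      \<open>x\<close>. Its difference is \<open>x ^ 2\<close>, which is nonnegative everywhere and
      vanishes only at \<open>n = m\<close>; being cubic, it is killed by four differences.\<close>
    define u where "u n = (2 * (real n - real m) ^ 3 - 3 * (real n - real m) ^ 2 + (real n - real m)) / 6" for n :: nat
    have "(step_diff p ^^ 4) u = (\<lambda>n. 0)"
      by (simp add: fun_eq_iff numeral_eq_Suc step_diff_def u_def flip: diff_divide_distrib) algebra
    then have "(step_diff p ^^ Suc d) u = (\<lambda>n. 0)"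
      by (rule funpow_step_diff_eq_0_mono) (use d in simp)
    then obtain h :: "real ^ 'n" where h: "L e p d h = u"
      using ex_L_eq[OF p e] by blast
    have f: "?f h n = (real n - real m) ^ 2" for n
      by (simp add: h step_diff_def u_def field_simps power2_eq_square power3_eq_cube)
    have "h \<in> G m" "h \<notin> G k"
      using that by (simp_all add: G_def C_eq_step_diff f del: One_nat_def)
    then show ?thesis
      by blast
  qed
  then have "inj_on G {N..}"
    by (meson inj_onI)
  then have "infinite (G ` {N..})"
    using finite_imageD infinite_Ici by blast
  moreover have "G ` {N..} \<subseteq> {F. F face_of C e p d N}"
    using face by auto
  ultimately show False
    using finite_polyhedron_faces[OF poly] finite_subset by blast
qed

theorem theorem4p6:
  fixes d p N :: nat and e :: "nat \<Rightarrow> 'n::finite"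
  assumes "d \<ge> 1" and "p \<ge> 1"
    and "bij_betw e {..<p * (d + 1)} (UNIV :: 'n set)"
  shows "polyhedron (C e p d N) \<longleftrightarrow> d = 1 \<or> d = 2"
proof
  assume "polyhedron (C e p d N)"
  then have "\<not> d \<ge> 3"
    using not_polyhedron_C[OF assms(2) bij_betw_imp_inj_on[OF assms(3)]] by blast
  then show "d = 1 \<or> d = 2"
    using assms(1) by linarith
qed (rule polyhedron_C[OF assms(2)])

end
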